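(* Let $\mathbb{F}\in\{\mathbb{R},\mathbb{C}\}$ and let $p\ge 2$. Assume that $\mathbb{F}^p$ has two orthogonal decompositions $\mathbb{F}^p=\mathcal{X}_1\oplus\mathcal{X}_2=\mathcal{Y}_1\oplus\mathcal{Y}_2$. Then there exists a two-dimensional linear subspace $\mathcal{Z}\subseteq\mathbb{F}^p$ that splits over both orthogonal decompositions, that is, $$\mathcal{Z}=(\mathcal{Z}\cap\mathcal{X}_1)\oplus(\mathcal{Z}\cap\mathcal{X}_2)=(\mathcal{Z}\cap\mathcal{Y}_1)\oplus(\mathcal{Z}\cap\mathcal{Y}_2).$$
   Context: $\mathbb{F}^p$ carries its standard inner product. An orthogonal decomposition $\mathbb{F}^p=\mathcal{X}_1\oplus\mathcal{X}_2$ means that $\mathcal{X}_1,\mathcal{X}_2$ are mutually orthogonal linear subspaces whose sum is $\mathbb{F}^p$. *)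

theory Defs
  imports "HOL-Analysis.Analysis"
begin

text \<open>
  Vectors in \<open>'a ^ 'p\<close> are handled over the scalar field \<open>'a\<close> itself, so subspaces and dimensions
  are \<open>vec.subspace\<close> and \<open>vec.dim\<close>. On \<open>complex ^ 'p\<close>, the library's \<open>inner\<close>, \<open>subspace\<close> and \<open>dim\<close>
  refer to the underlying real space and are not what is wanted.
\<close>

definition cinner :: "complex ^ 'p \<Rightarrow> complex ^ 'p \<Rightarrow> complex" where
  "cinner x y = (\<Sum>i\<in>UNIV. x $ i * cnj (y $ i))"

text \<open>
  The inner product is a parameter: \<open>inner\<close> for real scalars, \<open>cinner\<close> for complex ones. The
  summands may be the zero subspace.
\<close>

definition orthogonal_decomposition ::
    "('a::field ^ 'p \<Rightarrow> 'a ^ 'p \<Rightarrow> 'a) \<Rightarrow> ('a ^ 'p) set \<Rightarrow> ('a ^ 'p) set \<Rightarrow> bool" where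
  "orthogonal_decomposition ip X1 X2 \<longleftrightarrow>
     vec.subspace X1 \<and> vec.subspace X2 \<and>
     (\<forall>x\<in>X1. \<forall>y\<in>X2. ip x y = 0) \<and>
     {x + y |x y. x \<in> X1 \<and> y \<in> X2} = UNIV"

definition is_direct_sum ::
    "('a::field ^ 'p) set \<Rightarrow> ('a ^ 'p) set \<Rightarrow> ('a ^ 'p) set \<Rightarrow> bool" where
  "is_direct_sum Z U V \<longleftrightarrow>
     vec.subspace U \<and> vec.subspace V \<and> U \<inter> V = {0} \<and>
     Z = {u + v |u v. u \<in> U \<and> v \<in> V}"

definition splits_over ::
    "('a::field ^ 'p) set \<Rightarrow> ('a ^ 'p) set \<Rightarrow> ('a ^ 'p) set \<Rightarrow> bool" where
  "splits_over Z X1 X2 \<longleftrightarrow> is_direct_sum Z (Z \<inter> X1) (Z \<inter> X2)"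

end

theory Submission
  imports Defs
begin

text \<open>
  Let \<open>P\<close> and \<open>Q\<close> be the orthogonal projections onto \<open>X1\<close> and \<open>Y1\<close>. A subspace splits over
  \<open>X1 \<oplus> X2\<close> as soon as it is \<open>P\<close>-invariant (\<open>splits_over_if_invariant\<close>), so it is enough to find
  a plane that is invariant under both projections.

  Suppose that \<open>x\<close> in \<open>X1\<close> is an eigenvector of the compression of \<open>Q\<close> to \<open>X1\<close>, say
  \<open>P (Q x) = c x\<close>. Then \<open>span {x, Q x}\<close> is invariant under both: \<open>P\<close> fixes \<open>x\<close> and sends \<open>Q x\<close> to
  \<open>c x\<close>, while \<open>Q\<close> sends both vectors to \<open>Q x\<close>. Either this span is a plane, or \<open>x\<close> is a common
  eigenvector of \<open>P\<close> and \<open>Q\<close>. Such an \<open>x\<close> exists because the compression is self-adjoint. If \<open>X1\<close> is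
  zero, the same works with \<open>X2\<close>, that is, with \<open>I - P\<close> in place of \<open>P\<close>.

  The argument also works inside any nonzero subspace \<open>W\<close> invariant under both projections
  (\<open>plane_or_common_eigenvector\<close>). If no plane arises from the whole space, there is a common
  eigenvector \<open>x\<close>; its orthogonal complement is again invariant, and is nonzero since \<open>p \<ge> 2\<close>. If no
  plane arises there either, it contains a common eigenvector \<open>y\<close>, and \<open>span {x, y}\<close> is the plane
  (\<open>commonly_invariant_plane_exists\<close>).

  The eigenvector comes from maximizing a quadratic form over a unit sphere, which uses only the
  underlying real Euclidean structure. Hence the real and the complex case are treated together,
  in the locale \<open>scalar_product\<close>.
\<close>

section \<open>A variational eigenvector\<close>

text \<open>
  A maximizer of the Rayleigh quotient on \<open>S\<close> is an eigenvector for the maximal value \<open>c\<close>. Indeed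
  \<open>q v = c \<langle>v, v\<rangle> - \<langle>f v, v\<rangle>\<close> is nonnegative on \<open>S\<close> and vanishes at the maximizer \<open>x\<close>, so its
  derivative at \<open>x\<close> in every direction of \<open>S\<close> is zero; the direction \<open>c x - f x\<close> gives the claim.
\<close>

lemma self_adjoint_on_subspace_has_eigenvector:
  fixes f :: "'v::euclidean_space \<Rightarrow> 'v"
  assumes f: "linear f" and S: "subspace S" and inv: "f ` S \<subseteq> S"
    and adj: "\<And>x y. x \<in> S \<Longrightarrow> y \<in> S \<Longrightarrow> inner (f x) y = inner x (f y)"
    and nz: "S \<noteq> {0}"
  obtains x c where "x \<in> S" "x \<noteq> 0" "f x = c *\<^sub>R x"
proof -
  let ?K = "sphere 0 1 \<inter> S"
  obtain w where w: "w \<in> S" "w \<noteq> 0"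
    using nz subspace_0[OF S] by blast
  have "compact ?K"
    using closed_subspace[OF S] compact_Int_closed compact_sphere by blast
  moreover have "w /\<^sub>R norm w \<in> ?K"
    using w subspace_scale[OF S] by simp
  then have "?K \<noteq> {}"
    by blast
  moreover have "continuous_on ?K (\<lambda>x. inner (f x) x)"
    by (intro continuous_intros linear_continuous_on linear_conv_bounded_linear[THEN iffD1] f)
  ultimately obtain x where x: "x \<in> ?K" and
    max: "\<And>y. y \<in> ?K \<Longrightarrow> inner (f y) y \<le> inner (f x) x"
    using continuous_attains_sup[of ?K "\<lambda>x. inner (f x) x"] by blast
  define c where "c = inner (f x) x"
  define q where "q v = c * inner v v - inner (f v) v" for v
  have xS: "x \<in> S" and xx: "inner x x = 1"
    using x by (auto simp: dot_square_norm)
  have q_nonneg: "0 \<le> q v" if v: "v \<in> S" for v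
  proof (cases "v = 0")
    case False
    then have "v /\<^sub>R norm v \<in> ?K"
      using v subspace_scale[OF S] by simp
    from max[OF this] have "inner (f v) v / (norm v * norm v) \<le> c"
      by (simp add: c_def linear_scale[OF f] divide_inverse mult_ac)
    then show ?thesis
      using False by (simp add: q_def dot_square_norm divide_simps power2_eq_square)
  qed (simp add: q_def)
  define d where "d = c *\<^sub>R x - f x"
  have dS: "d \<in> S"
    unfolding d_def using xS inv S by (blast intro: subspace_diff subspace_scale)
  have expand: "q (x + t *\<^sub>R d) = 2 * t * inner d d + t\<^sup>2 * q d" for t
  proof -
    have fd_x: "inner (f d) x = inner (f x) d"
      using adj[OF dS xS] by (simp add: inner_commute)
    have dd: "inner d d = c * inner x d - inner (f x) d"
      by (subst (1) d_def) (simp add: inner_diff_left)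
    show ?thesis
      unfolding q_def dd linear_add[OF f] linear_scale[OF f] inner_add_left inner_add_right
        inner_scaleR_left inner_scaleR_right xx fd_x c_def[symmetric] inner_commute[of d x]
      by (simp add: algebra_simps power2_eq_square)
  qed
  have "d = 0"
  proof (rule ccontr)
    assume "d \<noteq> 0"
    then have pos: "0 < inner d d"
      by simp
    have qd: "0 \<le> q d"
      using q_nonneg dS .
    \<comment> \<open>The exact minimizer \<open>- inner d d / q d\<close> of the quadratic \<open>expand\<close> fails when \<open>q d = 0\<close>; the
      shift by 1 avoids this and still makes the value negative.\<close>
    define t where "t = - (inner d d / (q d + 1))"
    have "x + t *\<^sub>R d \<in> S"
      using xS dS S by (blast intro: subspace_add subspace_scale)
    from q_nonneg[OF this] have "0 \<le> t * (2 * inner d d + t * q d)"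
      unfolding expand by (simp add: algebra_simps power2_eq_square)
    moreover have "t < 0"
      using pos qd by (simp add: t_def)
    ultimately have "2 * inner d d + t * q d \<le> 0"
      by (simp add: zero_le_mult_iff)
    moreover have "t * q d = - inner d d * (q d / (q d + 1))"
      by (simp add: t_def)
    moreover have "inner d d * (q d / (q d + 1)) \<le> inner d d * 1"
      using pos qd by (intro mult_left_mono) auto
    ultimately show False
      using pos by simp
  qed
  then have "f x = c *\<^sub>R x"
    by (simp add: d_def)
  with that xS xx show thesis
    by force
qed

section \<open>Orthogonal projections\<close>

lemma scaleR_eq_vector_smult:
  fixes x :: "'a::real_normed_field ^ 'p"
  shows "r *\<^sub>R x = of_real r *s x"
  unfolding vec_eq_iff vector_scaleR_component vector_smult_component
  by (simp add: scaleR_conv_of_real)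

lemma vec_subspace_imp_subspace:
  fixes S :: "('a::real_normed_field ^ 'p) set"
  assumes "vec.subspace S"
  shows "subspace S"
  using assms by (simp add: vec.subspace_def subspace_def scaleR_eq_vector_smult)

lemma dim_span_pair:
  fixes x y :: "'a::field ^ 'p"
  assumes "x \<noteq> 0" and "y \<notin> vec.span {x}"
  shows "vec.dim (vec.span {x, y}) = 2"
proof -
  have "vec.independent {y, x}"
    using assms by (simp add: vec.independent_insert)
  moreover have "y \<noteq> x"
    using assms vec.span_base by blast
  ultimately show ?thesis
    using vec.dim_span_eq_card_independent[of "{y, x}"] by (simp add: insert_commute)
qed

text \<open>
  The two standard inner products share these properties, with \<open>re\<close> the identity on real scalars
  and the real part on complex ones. The last one ties orthogonality and self-adjointness over the
  scalar field to the real Euclidean structure. Conjugate symmetry appears only through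
  \<open>orthogonal_sym\<close>, so that no conjugation on \<open>'a\<close> has to be assumed.
\<close>

locale scalar_product =
  fixes ip :: "'a::{euclidean_space, real_normed_field} ^ 'p::finite \<Rightarrow> 'a ^ 'p \<Rightarrow> 'a"
    and re :: "'a \<Rightarrow> real"
  assumes add_left: "ip (x + y) z = ip x z + ip y z"
    and add_right: "ip z (x + y) = ip z x + ip z y"
    and scale_left: "ip (c *s x) y = c * ip x y"
    and orthogonal_sym: "ip x y = 0 \<Longrightarrow> ip y x = 0"
    and inner_eq: "inner x y = re (ip x y)"
begin

definition projection :: "('a ^ 'p \<Rightarrow> 'a ^ 'p) \<Rightarrow> bool" where
  "projection P \<longleftrightarrow> Vector_Spaces.linear (*s) (*s) P \<and> (\<forall>x. P (P x) = P x) \<and>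
     (\<forall>x y. ip (P x) y = ip x (P y))"

definition commonly_invariant_plane ::
    "('a ^ 'p \<Rightarrow> 'a ^ 'p) \<Rightarrow> ('a ^ 'p \<Rightarrow> 'a ^ 'p) \<Rightarrow> ('a ^ 'p) set \<Rightarrow> bool" where
  "commonly_invariant_plane P Q Z \<longleftrightarrow>
     vec.subspace Z \<and> vec.dim Z = 2 \<and> P ` Z \<subseteq> Z \<and> Q ` Z \<subseteq> Z"

lemma ip_zero_left [simp]: "ip 0 y = 0"
  using scale_left[of 0 0 y] by simp

lemma ip_diff_left: "ip (x - y) z = ip x z - ip y z"
  using add_left[of "x - y" y z] by simp

lemma ip_diff_right: "ip z (x - y) = ip z x - ip z y"
  using add_right[of z "x - y" y] by simp

lemma ip_self_nonzero:
  assumes "x \<noteq> 0"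
  shows "ip x x \<noteq> 0"
proof
  assume "ip x x = 0"
  then have "inner x x = inner 0 (0 :: 'a ^ 'p)"
    unfolding inner_eq by simp
  with assms show False
    by simp
qed

lemma projection_linear: "projection P \<Longrightarrow> Vector_Spaces.linear (*s) (*s) P"
  by (simp add: projection_def)

lemma projection_idem: "projection P \<Longrightarrow> P (P x) = P x"
  by (simp add: projection_def)

lemma projection_self_adjoint: "projection P \<Longrightarrow> ip (P x) y = ip x (P y)"
  by (simp add: projection_def)

lemma projection_real_linear:
  assumes "projection P"
  shows "linear P"
  using projection_linear[OF assms]
  by (intro linearI) (simp_all add: vec.linear_add vec.linear_scale scaleR_eq_vector_smult)

lemma projection_complement:
  assumes P: "projection P"
  shows "projection (\<lambda>x. x - P x)"
  unfolding projection_def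
proof (intro conjI allI)
  show "Vector_Spaces.linear (*s) (*s) (\<lambda>x. x - P x)"
    using projection_linear[OF P] by (intro vec.linear_compose_sub vec.linear_ident)
qed (use P in \<open>simp_all add: projection_idem projection_self_adjoint ip_diff_left ip_diff_right
    vec.linear_diff[OF projection_linear[OF P]]\<close>)

text \<open>
  The component of a vector in \<open>X1\<close> is unique because \<open>X1\<close> and \<open>X2\<close> are orthogonal. Linearity
  follows from this uniqueness, and self-adjointness since both \<open>ip (P x) y\<close> and \<open>ip x (P y)\<close>
  equal \<open>ip (P x) (P y)\<close>.
\<close>

lemma projection_of_decomposition:
  assumes "orthogonal_decomposition ip X1 X2"
  obtains P where "projection P" "X1 = {x. P x = x}" "X2 = {x. P x = 0}"
proof -
  have X1: "vec.subspace X1" and X2: "vec.subspace X2"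
    and orth: "\<And>x y. x \<in> X1 \<Longrightarrow> y \<in> X2 \<Longrightarrow> ip x y = 0"
    and sum: "{x + y |x y. x \<in> X1 \<and> y \<in> X2} = UNIV"
    using assms by (auto simp: orthogonal_decomposition_def)
  define P where "P x = (SOME u. u \<in> X1 \<and> x - u \<in> X2)" for x
  have "\<exists>u. u \<in> X1 \<and> x - u \<in> X2" for x
  proof -
    have "x \<in> {x + y |x y. x \<in> X1 \<and> y \<in> X2}"
      using sum by simp
    then show ?thesis
      by force
  qed
  then have "P x \<in> X1 \<and> x - P x \<in> X2" for x
    unfolding P_def by (rule someI_ex)
  then have PX1: "P x \<in> X1" and PX2: "x - P x \<in> X2" for x
    by auto
  have unique: "P x = u" if "u \<in> X1" "x - u \<in> X2" for x u
  proof -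
    have "P x - u \<in> X1"
      using PX1 that X1 by (simp add: vec.subspace_diff)
    moreover have "(x - u) - (x - P x) \<in> X2"
      using PX2 that X2 vec.subspace_diff by blast
    then have "P x - u \<in> X2"
      by simp
    ultimately have "ip (P x - u) (P x - u) = 0"
      by (rule orth)
    then show ?thesis
      using ip_self_nonzero[of "P x - u"] by auto
  qed
  have "P (x + y) = P x + P y" for x y
  proof (rule unique)
    show "P x + P y \<in> X1"
      using PX1 X1 by (simp add: vec.subspace_add)
    have "(x - P x) + (y - P y) \<in> X2"
      using PX2 X2 vec.subspace_add by blast
    then show "x + y - (P x + P y) \<in> X2"
      by (simp add: algebra_simps)
  qed
  moreover have "P (c *s x) = c *s P x" for c x
  proof (rule unique)
    show "c *s P x \<in> X1"
      using PX1 X1 by (simp add: vec.subspace_scale)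
    have "c *s (x - P x) \<in> X2"
      using PX2 X2 vec.subspace_scale by blast
    then show "c *s x - c *s P x \<in> X2"
      by (simp add: vec.scale_right_diff_distrib)
  qed
  ultimately have "Vector_Spaces.linear (*s) (*s) P"
    by (simp add: Vector_Spaces.linear_iff vec.vector_space_axioms)
  moreover have X1_iff: "P x = x \<longleftrightarrow> x \<in> X1" for x
    using PX1[of x] unique[of x x] vec.subspace_0[OF X2] by auto
  moreover have X2_iff: "P x = 0 \<longleftrightarrow> x \<in> X2" for x
    using PX2[of x] unique[of 0 x] vec.subspace_0[OF X1] by auto
  moreover have "ip (P x) y = ip x (P y)" for x y
  proof -
    have "ip (P x) (y - P y) = 0"
      using orth PX1 PX2 .
    moreover have "ip (x - P x) (P y) = 0"
      using orth[OF PX1 PX2] by (rule orthogonal_sym)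
    ultimately show ?thesis
      by (simp add: ip_diff_left ip_diff_right)
  qed
  moreover have "P (P x) = P x" for x
    using X1_iff PX1 by blast
  ultimately have "projection P"
    by (simp add: projection_def)
  then show thesis
    by (rule that) (simp_all only: X1_iff X2_iff Collect_mem_eq)
qed

text \<open>
  For \<open>z\<close> in \<open>Z\<close>, both parts of \<open>z = P z + (z - P z)\<close> lie in \<open>Z\<close>.
\<close>

lemma splits_over_if_invariant:
  assumes P: "projection P" and Z: "vec.subspace Z" and inv: "P ` Z \<subseteq> Z"
  shows "splits_over Z {x. P x = x} {x. P x = 0}"
proof -
  note lin = projection_linear[OF P]
  have sub: "vec.subspace {x. P x = x}" "vec.subspace {x. P x = 0}"
    by (auto simp: vec.subspace_def vec.linear_0[OF lin] vec.linear_add[OF lin]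
        vec.linear_scale[OF lin])
  have decompose: "z \<in> {u + v |u v. u \<in> Z \<inter> {x. P x = x} \<and> v \<in> Z \<inter> {x. P x = 0}}" if z: "z \<in> Z" for z
  proof -
    have "P z \<in> Z"
      using z inv by blast
    moreover from this have "z - P z \<in> Z"
      using z Z by (simp add: vec.subspace_diff)
    moreover have "P (z - P z) = 0"
      by (simp add: vec.linear_diff[OF lin] projection_idem[OF P])
    ultimately show ?thesis
      using projection_idem[OF P, of z]
      by (intro CollectI exI[of _ "P z"] exI[of _ "z - P z"]) auto
  qed
  then show ?thesis
    unfolding splits_over_def is_direct_sum_def
  proof (intro conjI)
    show "vec.subspace (Z \<inter> {x. P x = x})" "vec.subspace (Z \<inter> {x. P x = 0})"
      using Z sub by (blast intro: vec.subspace_inter)+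
    show "Z \<inter> {x. P x = x} \<inter> (Z \<inter> {x. P x = 0}) = {0}"
      using vec.subspace_0[OF Z] vec.linear_0[OF lin] by auto
    show "Z = {u + v |u v. u \<in> Z \<inter> {x. P x = x} \<and> v \<in> Z \<inter> {x. P x = 0}}"
    proof
      show "{u + v |u v. u \<in> Z \<inter> {x. P x = x} \<and> v \<in> Z \<inter> {x. P x = 0}} \<subseteq> Z"
        using vec.subspace_add[OF Z] by blast
    qed (use decompose in blast)
  qed
qed

lemma projection_span_invariant:
  assumes "projection P" and "\<And>b. b \<in> B \<Longrightarrow> P b \<in> vec.span B"
  shows "P ` vec.span B \<subseteq> vec.span B"
proof -
  have "P ` vec.span B = vec.span (P ` B)"
    using vec.linear_span_image[OF projection_linear[OF assms(1)]] by simp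
  also have "\<dots> \<subseteq> vec.span B"
    using assms(2) by (intro vec.span_minimal vec.subspace_span) auto
  finally show ?thesis .
qed

section \<open>Planes invariant under two projections\<close>

text \<open>
  The vector \<open>w\<close> only ensures that \<open>W \<inter> range P\<close> is nonzero. On that subspace \<open>P \<circ> Q\<close> is
  self-adjoint, being there the same as \<open>P \<circ> Q \<circ> P\<close>.
\<close>

lemma compression_has_eigenvector:
  assumes P: "projection P" and Q: "projection Q"
    and W: "vec.subspace W" "P ` W \<subseteq> W" "Q ` W \<subseteq> W"
    and w: "w \<in> W" "P w \<noteq> 0"
  obtains x c where "x \<in> W" "x \<noteq> 0" "P x = x" "P (Q x) = c *s x"
proof -
  let ?S = "W \<inter> {x. P x = x}"
  note linP = projection_linear[OF P] and linQ = projection_linear[OF Q]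
  have "vec.subspace {x. P x = x}"
    by (auto simp: vec.subspace_def vec.linear_0[OF linP] vec.linear_add[OF linP]
        vec.linear_scale[OF linP])
  then have "subspace ?S"
    using W by (intro vec_subspace_imp_subspace vec.subspace_inter)
  moreover have "linear (\<lambda>x. P (Q x))"
    using linear_compose[OF projection_real_linear[OF Q] projection_real_linear[OF P]]
    by (simp add: o_def)
  moreover have "(\<lambda>x. P (Q x)) ` ?S \<subseteq> ?S"
    using W by (auto simp: projection_idem[OF P])
  moreover have "inner (P (Q x)) y = inner x (P (Q y))" if "x \<in> ?S" "y \<in> ?S" for x y
  proof -
    have "ip (P (Q x)) y = ip x (Q (P y))"
      by (simp add: projection_self_adjoint P Q)
    also have "\<dots> = ip (P x) (Q y)"
      using that by simp
    also have "\<dots> = ip x (P (Q y))"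
      by (rule projection_self_adjoint[OF P])
    finally show ?thesis
      by (simp add: inner_eq)
  qed
  moreover have "P w \<in> ?S"
    using w W by (auto simp: projection_idem[OF P])
  then have "?S \<noteq> {0}"
    using w by blast
  ultimately obtain x c where "x \<in> ?S" "x \<noteq> 0" "P (Q x) = c *\<^sub>R x"
    using self_adjoint_on_subspace_has_eigenvector[of "\<lambda>x. P (Q x)" ?S] by blast
  then show thesis
    using that[of x "of_real c"] by (simp add: scaleR_eq_vector_smult)
qed

text \<open>
  The two branches for \<open>w\<close> correspond to compressing \<open>Q\<close> to the range or to the kernel of \<open>P\<close>. Both
  give an eigenvector \<open>x\<close> of \<open>P\<close> for which \<open>span {x, Q x}\<close> is invariant under \<open>P\<close> and \<open>Q\<close>. If
  that span is only a line, then \<open>Q x = c x\<close>, and \<open>c\<close> is 0 or 1 because \<open>Q\<close> is idempotent.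
\<close>

lemma plane_or_common_eigenvector:
  assumes P: "projection P" and Q: "projection Q"
    and W: "vec.subspace W" "P ` W \<subseteq> W" "Q ` W \<subseteq> W" "W \<noteq> {0}"
  shows "(\<exists>Z. commonly_invariant_plane P Q Z) \<or>
    (\<exists>x\<in>W. x \<noteq> 0 \<and> P x \<in> {0, x} \<and> Q x \<in> {0, x})"
proof -
  obtain w where w: "w \<in> W" "w \<noteq> 0"
    using W vec.subspace_0 by blast
  obtain x where x: "x \<in> W" "x \<noteq> 0" "P x \<in> {0, x}" "P (Q x) \<in> vec.span {x, Q x}"
  proof (cases "P w = 0")
    case False
    from compression_has_eigenvector[OF P Q W(1-3) w(1) False]
    obtain x c where "x \<in> W" "x \<noteq> 0" "P x = x" "P (Q x) = c *s x" .
    then show thesis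
      using that[of x] by (simp add: vec.span_base vec.span_scale)
  next
    case True
    have "(\<lambda>x. x - P x) ` W \<subseteq> W"
      using W by (auto intro: vec.subspace_diff)
    moreover have "w - P w \<noteq> 0"
      using w True by simp
    ultimately obtain x c where x: "x \<in> W" "x \<noteq> 0" "x - P x = x" "Q x - P (Q x) = c *s x"
      using compression_has_eigenvector[OF projection_complement[OF P] Q W(1) _ W(3) w(1)]
      by metis
    then have "P (Q x) = Q x - c *s x"
      by (simp add: algebra_simps)
    with x that[of x] show thesis
      by (simp add: vec.span_base vec.span_scale vec.span_diff)
  qed
  let ?Z = "vec.span {x, Q x}"
  have "P ` ?Z \<subseteq> ?Z"
    using x by (intro projection_span_invariant[OF P]) (auto intro: vec.span_base vec.span_zero)
  moreover have "Q ` ?Z \<subseteq> ?Z"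
    by (intro projection_span_invariant[OF Q]) (auto simp: projection_idem[OF Q] vec.span_base)
  ultimately have plane: "commonly_invariant_plane P Q ?Z" if "Q x \<notin> vec.span {x}"
    using dim_span_pair[OF x(2) that] by (simp add: commonly_invariant_plane_def)
  have "Q x \<in> {0, x}" if Qx: "Q x \<in> vec.span {x}"
  proof -
    obtain c where c: "Q x = c *s x"
      using Qx unfolding vec.span_singleton by blast
    then have "c *s (c *s x) = c *s x"
      using projection_idem[OF Q, of x] vec.linear_scale[OF projection_linear[OF Q]] by metis
    then have "c * c = c"
      using x(2) by (metis vec.scale_scale vec.scale_right_imp_eq)
    then have "c = 0 \<or> c = 1"
      by simp
    then show ?thesis
      using c by auto
  qed
  then show ?thesis
    using plane x by blast
qed

text \<open>
  Two applications of the preceding dichotomy: the second one, in the orthogonal complement of a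
  common eigenvector \<open>x\<close>, supplies a second common eigenvector independent of \<open>x\<close>.
\<close>

lemma commonly_invariant_plane_exists:
  assumes P: "projection P" and Q: "projection Q" and card: "2 \<le> CARD('p)"
  shows "\<exists>Z. commonly_invariant_plane P Q Z"
proof (rule ccontr)
  assume no_plane: "\<nexists>Z. commonly_invariant_plane P Q Z"
  have "(UNIV :: ('a ^ 'p) set) \<noteq> {0}"
    using card vec_dim_card[where 'a = 'a and 'n = 'p] by force
  then obtain x where x: "x \<noteq> 0" "P x \<in> {0, x}" "Q x \<in> {0, x}"
    using plane_or_common_eigenvector[OF P Q, of UNIV] no_plane by auto
  define W where "W = {w. ip w x = 0}"
  have W: "vec.subspace W"
    by (simp add: W_def vec.subspace_def add_left scale_left)
  have inv: "R ` W \<subseteq> W" if R: "projection R" "R x \<in> {0, x}" for R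
  proof -
    have "ip (R w) x = 0" if "ip w x = 0" for w
    proof -
      have "ip x (R w) = ip (R x) w"
        by (simp add: projection_self_adjoint[OF R(1)])
      also have "\<dots> = 0"
        using R(2) orthogonal_sym[OF that] by auto
      finally show ?thesis
        by (rule orthogonal_sym)
    qed
    then show ?thesis
      by (auto simp: W_def)
  qed
  have "W \<noteq> {0}"
  proof
    assume W0: "W = {0}"
    have "y \<in> vec.span {x}" for y
    proof -
      have "y - (ip y x / ip x x) *s x \<in> W"
        using ip_self_nonzero[OF x(1)] by (simp add: W_def ip_diff_left scale_left)
      then show ?thesis
        using W0 by (auto simp: vec.span_singleton)
    qed
    then have "(UNIV :: ('a ^ 'p) set) \<subseteq> vec.span {x}"
      by blast
    then have "vec.dim (UNIV :: ('a ^ 'p) set) \<le> card {x}"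
      by (rule vec.dim_le_card) simp
    with card show False
      unfolding vec_dim_card by simp
  qed
  then obtain y where y: "y \<in> W" "y \<noteq> 0" "P y \<in> {0, y}" "Q y \<in> {0, y}"
    using plane_or_common_eigenvector[OF P Q W inv[OF P x(2)] inv[OF Q x(3)]] no_plane by auto
  have "y \<notin> vec.span {x}"
    using y ip_self_nonzero[OF x(1)] by (auto simp: W_def vec.span_singleton scale_left)
  then have "vec.dim (vec.span {x, y}) = 2"
    using dim_span_pair x by blast
  moreover have "R ` vec.span {x, y} \<subseteq> vec.span {x, y}"
    if "projection R" "R x \<in> {0, x}" "R y \<in> {0, y}" for R
    using that by (intro projection_span_invariant) (auto intro: vec.span_base vec.span_zero)
  ultimately have "commonly_invariant_plane P Q (vec.span {x, y})"
    using P Q x y by (simp add: commonly_invariant_plane_def)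
  with no_plane show False
    by blast
qed

lemma plane_splits_over_both:
  assumes "2 \<le> CARD('p)"
    and "orthogonal_decomposition ip X1 X2" and "orthogonal_decomposition ip Y1 Y2"
  shows "\<exists>Z. vec.subspace Z \<and> vec.dim Z = 2 \<and> splits_over Z X1 X2 \<and> splits_over Z Y1 Y2"
proof -
  obtain P where P: "projection P" "X1 = {x. P x = x}" "X2 = {x. P x = 0}"
    using projection_of_decomposition assms(2) .
  obtain Q where Q: "projection Q" "Y1 = {x. Q x = x}" "Y2 = {x. Q x = 0}"
    using projection_of_decomposition assms(3) .
  obtain Z where "commonly_invariant_plane P Q Z"
    using commonly_invariant_plane_exists[OF P(1) Q(1) assms(1)] by blast
  then show ?thesis
    using splits_over_if_invariant P Q unfolding commonly_invariant_plane_def by blast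
qed

end

section \<open>The real and the complex case\<close>

interpretation real_product: scalar_product "inner :: real ^ 'p::finite \<Rightarrow> _" "\<lambda>c. c"
proof
  fix x y z :: "real ^ 'p" and c :: real
  show "inner (x + y) z = inner x z + inner y z"
    by (rule inner_add_left)
  show "inner z (x + y) = inner z x + inner z y"
    by (rule inner_add_right)
  show "inner (c *s x) y = c * inner x y"
    by (simp add: inner_vec_def sum_distrib_left mult.assoc)
  show "inner y x = 0" if "inner x y = 0"
    using that by (simp add: inner_commute)
qed (rule refl)

interpretation complex_product: scalar_product "cinner :: complex ^ 'p::finite \<Rightarrow> _" Re
proof
  fix x y z :: "complex ^ 'p" and c :: complex
  show "cinner (x + y) z = cinner x z + cinner y z"
    by (simp add: cinner_def distrib_right sum.distrib)
  show "cinner z (x + y) = cinner z x + cinner z y"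
    by (simp add: cinner_def distrib_left sum.distrib)
  show "cinner (c *s x) y = c * cinner x y"
    by (simp add: cinner_def sum_distrib_left mult.assoc)
  have "cinner y x = cnj (cinner x y)"
    by (simp add: cinner_def mult.commute)
  then show "cinner y x = 0" if "cinner x y = 0"
    using that by simp
  show "inner x y = Re (cinner x y)"
    by (simp add: cinner_def inner_vec_def inner_complex_def)
qed

theorem proposition3p2:
  assumes "2 \<le> CARD('p::finite)"
  shows
    "(\<forall>X1 X2 Y1 Y2 :: (real ^ 'p) set.
        orthogonal_decomposition inner X1 X2 \<and> orthogonal_decomposition inner Y1 Y2 \<longrightarrow>
        (\<exists>Z. vec.subspace Z \<and> vec.dim Z = 2 \<and> splits_over Z X1 X2 \<and> splits_over Z Y1 Y2)) \<and>
     (\<forall>X1 X2 Y1 Y2 :: (complex ^ 'p) set.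
        orthogonal_decomposition cinner X1 X2 \<and> orthogonal_decomposition cinner Y1 Y2 \<longrightarrow>
        (\<exists>Z. vec.subspace Z \<and> vec.dim Z = 2 \<and> splits_over Z X1 X2 \<and> splits_over Z Y1 Y2))"
  using real_product.plane_splits_over_both[OF assms]
    complex_product.plane_splits_over_both[OF assms] by blast

end
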